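(* Let $G$ be a finite group and let $a,b,x\in G$. Then the matrix \[ Q_p = \begin{pmatrix} 1 & p(a) & p(x) \\ \overline{p(a)} & 1 & p(b)\\ \overline{p(x)} & \overline{p(b)} & 1 \end{pmatrix} \] belongs to $M_3(\mathbb{C})^+$ for every $p\in K(G)$ if and only if $x=ab$ or $x=ba$.
   Context: For a finite group $G$ with identity $e$, $K(G)$ (the state space of $G$) is the set of positive definite functions $p:G\to\mathbb{C}$ with $p(e)=1$. Here $p$ is positive definite if $\sum_{j,k=1}^n \overline{c_j}c_k\,p(g_j^{-1}g_k)\ge 0$ for all $n\in\mathbb{N}$, $g_1,\dots,g_n\in G$, $c_1,\dots,c_n\in\mathbb{C}$. $M_3(\mathbb{C})^+$ denotes the set of positive (i.e. positive semidefinite Hermitian) $3\times 3$ complex matrices. *)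

theory Defs
  imports "HOL-Analysis.Analysis" "HOL-Algebra.Group"
begin

text \<open>The set \<open>\<real>\<^sub>\<ge>\<^sub>0\<close> of complex numbers encodes ``\<open>z \<ge> 0\<close>'', i.e. \<open>z\<close> is real and nonnegative.\<close>

definition positive_definite :: "('a, 'b) monoid_scheme \<Rightarrow> ('a \<Rightarrow> complex) \<Rightarrow> bool" where
  "positive_definite G p \<longleftrightarrow>
     (\<forall>(n::nat) (g :: nat \<Rightarrow> 'a) (c :: nat \<Rightarrow> complex).
        (\<forall>j<n. g j \<in> carrier G) \<longrightarrow>
        (\<Sum>j<n. \<Sum>k<n. cnj (c j) * c k * p (inv\<^bsub>G\<^esub> (g j) \<otimes>\<^bsub>G\<^esub> g k)) \<in> \<real>\<^sub>\<ge>\<^sub>0)"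

text \<open>Functions on \<open>G\<close> are represented as functions that are \<open>undefined\<close> off the carrier.\<close>

definition state_space :: "('a, 'b) monoid_scheme \<Rightarrow> ('a \<Rightarrow> complex) set" where
  "state_space G = {p \<in> extensional (carrier G). positive_definite G p \<and> p \<one>\<^bsub>G\<^esub> = 1}"

definition positive_matrices :: "(complex ^ 'n ^ 'n) set" where
  "positive_matrices =
     {A. (\<forall>i j. A $ i $ j = cnj (A $ j $ i)) \<and>
         (\<forall>v :: complex ^ 'n. (\<Sum>i\<in>UNIV. \<Sum>j\<in>UNIV. cnj (v $ i) * A $ i $ j * v $ j) \<in> \<real>\<^sub>\<ge>\<^sub>0)}"

definition Q_matrix :: "('a \<Rightarrow> complex) \<Rightarrow> 'a \<Rightarrow> 'a \<Rightarrow> 'a \<Rightarrow> complex ^ 3 ^ 3" where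
  "Q_matrix p a b x =
     vector [vector [1,         p a,       p x],
             vector [cnj (p a), 1,         p b],
             vector [cnj (p x), cnj (p b), 1]]"

end

theory Submission
  imports Defs "HOL-Algebra.Multiplicative_Group"
begin

text \<open>If \<open>x = ab\<close>, then \<open>Q_p\<close> is the matrix \<open>p(g\<^sub>j\<^sup>-\<^sup>1 g\<^sub>k)\<close> of the points \<open>e, a, ab\<close>; if \<open>x = ba\<close>,
  it is the transpose of the matrix of the points \<open>e, a\<^sup>-\<^sup>1, (ba)\<^sup>-\<^sup>1\<close>.

  For the converse, let \<open>n = |G|\<close>, \<open>u\<^sup>n = 1\<close>, and let \<open>\<eta>\<^sub>u = \<Sum>\<^sub>j u\<^sup>j a\<^sup>-\<^sup>j\<close> in the group algebra, so that
  \<open>a \<eta>\<^sub>u = u \<eta>\<^sub>u\<close>. For \<open>w\<close> in the group algebra put \<open>\<xi> = w \<eta>\<^sub>u\<close> and \<open>p(g) = \<langle>g\<xi>, \<xi>\<rangle>\<close>, and evaluate the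
  form of \<open>Q_p\<close> at \<open>(-u, 1, c)\<close>. Since \<open>cnj u a w \<eta>\<^sub>u = (a w a\<^sup>-\<^sup>1) \<eta>\<^sub>u\<close>, summing over all \<open>u\<close> leaves inner
  products in \<open>\<ell>\<^sup>2(G)\<close> of translates of \<open>w\<close>. Now replace \<open>c\<close> by \<open>c/2\<close>, take \<open>w = e + c f + cnj c h\<close> with real
  \<open>f\<close> and \<open>h\<close>, and average over \<open>c \<in> {1, -1, i, -i}\<close>: the linear and cubic terms cancel, and \<open>f\<close> and \<open>h\<close>
  decouple. If \<open>x\<close> is neither \<open>ab\<close> nor \<open>ba\<close>, the resulting inequality fails for
  \<open>f = (x a\<^sup>-\<^sup>1 - b)/6\<close> and \<open>h = (x\<^sup>-\<^sup>1 a - b\<^sup>-\<^sup>1)/6\<close>.\<close>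

section \<open>The quadratic form of \<open>Q_p\<close> and averages over roots of unity\<close>

lemma sum_lessThan_3: "(\<Sum>j<3. f j) = f 0 + f 1 + f (2::nat)" for f :: "nat \<Rightarrow> 'c::comm_monoid_add"
  by (simp add: numeral_3_eq_3 numeral_2_eq_2)

lemma Q_matrix_quadratic_form:
  "(\<Sum>i\<in>UNIV. \<Sum>j\<in>UNIV. cnj (v $ i) * Q_matrix p a b x $ i $ j * v $ j) =
     cnj (v $ 1) * v $ 1 + cnj (v $ 2) * v $ 2 + cnj (v $ 3) * v $ 3
     + cnj (v $ 1) * v $ 2 * p a + cnj (v $ 2) * v $ 1 * cnj (p a)
     + cnj (v $ 1) * v $ 3 * p x + cnj (v $ 3) * v $ 1 * cnj (p x)
     + cnj (v $ 2) * v $ 3 * p b + cnj (v $ 3) * v $ 2 * cnj (p b)"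
  by (simp add: sum_3 Q_matrix_def vector_3 algebra_simps)

lemma Q_matrix_hermitian: "Q_matrix p a b x $ i $ j = cnj (Q_matrix p a b x $ j $ i)"
proof -
  have "\<forall>i j. Q_matrix p a b x $ i $ j = cnj (Q_matrix p a b x $ j $ i)"
    by (simp add: forall_3 Q_matrix_def vector_3)
  then show ?thesis by blast
qed

text \<open>Every summand is the \<open>k\<close>-th power of the \<open>n\<close>-th root of unity
  \<open>?t\<close>. The bounds on \<open>i\<close> and \<open>j\<close> keep their difference below
  \<open>n\<close>, so \<open>?t = 1\<close> forces \<open>i = j\<close>; otherwise the geometric
  sum vanishes.\<close>

lemma sum_roots_of_unity_power:
  fixes i j n :: nat
  assumes "i < n" "j < n"
  shows "(\<Sum>k<n. cis (2 * pi * real k / real n) ^ i * cnj (cis (2 * pi * real k / real n) ^ j))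
           = (if i = j then of_nat n else 0)"
proof -
  let ?t = "cis (2 * pi * (real i - real j) / real n)"
  have n: "n > 0" using assms by simp
  have "cis (2 * pi * real k / real n) ^ i * cnj (cis (2 * pi * real k / real n) ^ j) = ?t ^ k" for k
    by (simp add: Complex.DeMoivre cis_cnj cis_mult diff_divide_distrib algebra_simps)
  then have eq: "(\<Sum>k<n. cis (2 * pi * real k / real n) ^ i * cnj (cis (2 * pi * real k / real n) ^ j))
      = (\<Sum>k<n. ?t ^ k)" by simp
  show ?thesis
  proof (cases "i = j")
    case True
    then show ?thesis unfolding eq by simp
  next
    case False
    have "?t \<noteq> 1"
    proof
      assume "?t = 1"
      then have "cos (2 * pi * (real i - real j) / real n) = 1"
        by (metis cis.sel(1) one_complex.sel(1))
      then obtain m :: int where "2 * pi * (real i - real j) / real n = of_int m * 2 * pi"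
        using cos_one_2pi_int by blast
      then have "2 * pi * (real i - real j) = 2 * pi * (of_int m * real n)"
        using n by (simp add: field_simps)
      then have "real i - real j = of_int m * real n"
        by (simp only: mult_cancel_left) simp
      then have "int i - int j = m * int n"
        by (metis of_int_diff of_int_eq_iff of_int_mult of_int_of_nat_eq)
      moreover have "\<bar>int i - int j\<bar> < int n" using assms by linarith
      ultimately have "\<bar>m\<bar> * int n < 1 * int n" by (simp add: abs_mult)
      then have "m = 0" using n by (simp only: mult_less_cancel_right) auto
      with \<open>int i - int j = m * int n\<close> False show False by simp
    qed
    moreover have "?t ^ n = 1"
    proof -
      have "?t ^ n = cis (2 * pi * of_int (int i - int j))"
        using n by (simp add: Complex.DeMoivre)
      then show ?thesis by (simp only: cis_multiple_2pi Ints_of_int)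
    qed
    ultimately show ?thesis unfolding eq using False by (simp add: geometric_sum)
  qed
qed

text \<open>For fourth roots of unity \<open>cnj c\<close> inverts \<open>c\<close>, and powers of
  \<open>c\<close> sum to 0 unless 4 divides the exponent. Both expansions have exponents between -2
  and 3 only, so exactly the constant terms survive.\<close>

lemma average_fourth_roots:
  fixes u v f f' h h' :: complex
  shows "(\<Sum>c\<in>{1, -1, \<i>, -\<i>}. (u + c * f + cnj c * h) * cnj (u' + c * f' + cnj c * h'))
           = 4 * (u * cnj u' + f * cnj f' + h * cnj h')" (is ?A)
    and "(\<Sum>c\<in>{1, -1, \<i>, -\<i>}. c * ((u + c * f + cnj c * h) * cnj (u' + c * f' + cnj c * h')))
           = 4 * (u * cnj f' + h * cnj u')" (is ?B)
proof -
  have d: "(1::complex) \<noteq> \<i>" "(1::complex) \<noteq> -\<i>" "-1 \<noteq> \<i>" "-1 \<noteq> -\<i>"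
    by (auto simp: complex_eq_iff)
  show ?A ?B
    using d by (simp_all add: algebra_simps)
qed

section \<open>Positive definite functions from the left regular representation\<close>

context group
begin

definition matrix_coeff :: "('a \<Rightarrow> complex) \<Rightarrow> 'a \<Rightarrow> complex" where
  "matrix_coeff \<xi> g = (\<Sum>y\<in>carrier G. \<xi> (inv g \<otimes> y) * cnj (\<xi> y))"

lemma sum_left_translate:
  assumes "g \<in> carrier G"
  shows "(\<Sum>y\<in>carrier G. F (g \<otimes> y)) = (\<Sum>y\<in>carrier G. F y)"
  by (rule sum.reindex_bij_witness[where i = "\<lambda>y. inv g \<otimes> y" and j = "\<lambda>y. g \<otimes> y"])
     (use assms in \<open>auto simp: m_assoc[symmetric]\<close>)

lemma sum_right_translate:
  assumes "g \<in> carrier G"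
  shows "(\<Sum>y\<in>carrier G. F (y \<otimes> g)) = (\<Sum>y\<in>carrier G. F y)"
  by (rule sum.reindex_bij_witness[where i = "\<lambda>y. y \<otimes> inv g" and j = "\<lambda>y. y \<otimes> g"])
     (use assms in \<open>auto simp: m_assoc\<close>)

text \<open>Left translation is unitary, so \<open>inv g\<close> moves to the other side of the
  inner product as \<open>g\<close>.\<close>

lemma matrix_coeff_inv_mult:
  assumes "g \<in> carrier G" "h \<in> carrier G"
  shows "matrix_coeff \<xi> (inv g \<otimes> h) =
           (\<Sum>y\<in>carrier G. \<xi> (inv h \<otimes> y) * cnj (\<xi> (inv g \<otimes> y)))"
proof -
  have "(\<Sum>y\<in>carrier G. \<xi> (inv h \<otimes> y) * cnj (\<xi> (inv g \<otimes> y)))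
      = (\<Sum>y\<in>carrier G. \<xi> (inv h \<otimes> (g \<otimes> y)) * cnj (\<xi> (inv g \<otimes> (g \<otimes> y))))"
    by (rule sum_left_translate[OF assms(1), symmetric])
  also have "\<dots> = matrix_coeff \<xi> (inv g \<otimes> h)"
    unfolding matrix_coeff_def using assms
    by (intro sum.cong) (auto simp: inv_mult_group m_assoc[symmetric])
  finally show ?thesis ..
qed

text \<open>The double sum is the squared norm of the combination \<open>?s\<close> of translates of
  \<xi>.\<close>

lemma positive_definite_matrix_coeff: "positive_definite G (matrix_coeff \<xi>)"
  unfolding positive_definite_def
proof (intro allI impI)
  fix n :: nat and g :: "nat \<Rightarrow> 'a" and c :: "nat \<Rightarrow> complex"
  assume g: "\<forall>j<n. g j \<in> carrier G"
  let ?s = "\<lambda>y. \<Sum>k<n. c k * \<xi> (inv (g k) \<otimes> y)"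
  have "(\<Sum>j<n. \<Sum>k<n. cnj (c j) * c k * matrix_coeff \<xi> (inv (g j) \<otimes> g k))
      = (\<Sum>j<n. \<Sum>k<n. \<Sum>y\<in>carrier G.
           (c k * \<xi> (inv (g k) \<otimes> y)) * cnj (c j * \<xi> (inv (g j) \<otimes> y)))"
    using g by (intro sum.cong) (auto simp: matrix_coeff_inv_mult sum_distrib_left mult_ac)
  also have "\<dots> = (\<Sum>j<n. \<Sum>y\<in>carrier G. \<Sum>k<n.
           (c k * \<xi> (inv (g k) \<otimes> y)) * cnj (c j * \<xi> (inv (g j) \<otimes> y)))"
    by (intro sum.cong refl sum.swap)
  also have "\<dots> = (\<Sum>y\<in>carrier G. \<Sum>j<n. \<Sum>k<n.
           (c k * \<xi> (inv (g k) \<otimes> y)) * cnj (c j * \<xi> (inv (g j) \<otimes> y)))"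
    by (rule sum.swap)
  also have "\<dots> = (\<Sum>y\<in>carrier G. ?s y * cnj (?s y))"
    by (simp add: sum_distrib_left sum_distrib_right)
  also have "\<dots> = of_real (\<Sum>y\<in>carrier G. (cmod (?s y))\<^sup>2)"
    by (simp only: of_real_sum complex_norm_square)
  finally show "(\<Sum>j<n. \<Sum>k<n. cnj (c j) * c k * matrix_coeff \<xi> (inv (g j) \<otimes> g k)) \<in> \<real>\<^sub>\<ge>\<^sub>0"
    by (simp only: nonneg_Reals_of_real_iff) (simp add: sum_nonneg)
qed

text \<open>The form at the points \<open>\<one>\<close> and \<open>g\<close> with coefficients 1
  and \<open>c\<close> is real: \<open>c = 1\<close> determines the imaginary part of
  \<open>p (inv g)\<close>, and \<open>c = \<i>\<close> the real part.\<close>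

lemma positive_definite_cnj:
  assumes "positive_definite G p" "g \<in> carrier G" "p \<one> = 1"
  shows "p (inv g) = cnj (p g)"
proof -
  have *: "1 + (cnj c * c + (cnj c * p (inv g) + c * p g)) \<in> \<real>\<^sub>\<ge>\<^sub>0" for c
    using assms(1)[unfolded positive_definite_def, rule_format, of 2 "\<lambda>j. if j = 0 then \<one> else g"
        "\<lambda>j. if j = 0 then 1 else c"] assms(2,3)
    by (simp add: numeral_2_eq_2 algebra_simps)
  show ?thesis
    using *[of 1] *[of \<i>] by (auto simp: complex_nonneg_Reals_iff complex_eq_iff)
qed

section \<open>Sufficiency of the two product conditions\<close>

lemma Q_matrix_positive_if_mult:
  assumes p: "positive_definite G p" "p \<one> = 1" and G: "a \<in> carrier G" "b \<in> carrier G"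
  shows "Q_matrix p a b (a \<otimes> b) \<in> positive_matrices"
  unfolding positive_matrices_def
proof (intro CollectI conjI allI Q_matrix_hermitian)
  fix v :: "complex ^ 3"
  have "inv (a \<otimes> b) \<otimes> a = inv b" using G by (simp add: inv_mult_group m_assoc)
  moreover have "inv a \<otimes> (a \<otimes> b) = b" using G by (simp add: m_assoc[symmetric])
  ultimately show "(\<Sum>i\<in>UNIV. \<Sum>j\<in>UNIV. cnj (v $ i) * Q_matrix p a b (a \<otimes> b) $ i $ j * v $ j) \<in> \<real>\<^sub>\<ge>\<^sub>0"
    using p(1)[unfolded positive_definite_def, rule_format, of 3
        "\<lambda>j. if j = 0 then \<one> else if j = 1 then a else a \<otimes> b"
        "\<lambda>j. if j = 0 then v $ 1 else if j = 1 then v $ 2 else v $ 3"] G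
    unfolding Q_matrix_quadratic_form
    by (simp add: sum_lessThan_3 p(2) positive_definite_cnj[OF p(1) _ p(2), symmetric] add_ac)
qed

lemma Q_matrix_positive_if_mult_swap:
  assumes p: "positive_definite G p" "p \<one> = 1" and G: "a \<in> carrier G" "b \<in> carrier G"
  shows "Q_matrix p a b (b \<otimes> a) \<in> positive_matrices"
  unfolding positive_matrices_def
proof (intro CollectI conjI allI Q_matrix_hermitian)
  fix v :: "complex ^ 3"
  have "a \<otimes> inv (b \<otimes> a) = inv b" using G by (simp add: inv_mult_group m_assoc[symmetric])
  moreover have "b \<otimes> a \<otimes> inv a = b" using G by (simp add: m_assoc)
  ultimately show "(\<Sum>i\<in>UNIV. \<Sum>j\<in>UNIV. cnj (v $ i) * Q_matrix p a b (b \<otimes> a) $ i $ j * v $ j) \<in> \<real>\<^sub>\<ge>\<^sub>0"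
    \<comment> \<open>Conjugating the coefficients accounts for the transpose.\<close>
    using p(1)[unfolded positive_definite_def, rule_format, of 3
        "\<lambda>j. if j = 0 then \<one> else if j = 1 then inv a else inv (b \<otimes> a)"
        "\<lambda>j. if j = 0 then cnj (v $ 1) else if j = 1 then cnj (v $ 2) else cnj (v $ 3)"] G
    unfolding Q_matrix_quadratic_form
    by (simp add: sum_lessThan_3 p(2) positive_definite_cnj[OF p(1) _ p(2), symmetric] mult_ac add_ac)
qed

section \<open>Necessity: the form of \<open>Q_p\<close> for matrix coefficients\<close>

lemma matrix_coeff_one: "matrix_coeff \<xi> \<one> = of_real (\<Sum>y\<in>carrier G. (cmod (\<xi> y))\<^sup>2)"
  unfolding matrix_coeff_def of_real_sum complex_norm_square by (intro sum.cong) auto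

text \<open>The form is taken at \<open>(-u, 1, c)\<close> for the normalised matrix coefficient of
  \<xi>, and the squared norm of \<xi> is then cleared, so that the inequality also covers \<xi> =
  0.\<close>

lemma form_matrix_coeff_nonneg:
  fixes u c :: complex
  assumes fin: "finite (carrier G)"
    and Q: "\<forall>p\<in>state_space G. Q_matrix p a b x \<in> positive_matrices"
    and G: "a \<in> carrier G" "b \<in> carrier G" "x \<in> carrier G"
    and u: "cmod u = 1"
  shows "Re ((2 + (cmod c)\<^sup>2) * matrix_coeff \<xi> \<one> - 2 * (cnj u * matrix_coeff \<xi> a)
           + 2 * c * (matrix_coeff \<xi> b - cnj u * matrix_coeff \<xi> x)) \<ge> 0"
proof -
  define N where "N = (\<Sum>y\<in>carrier G. (cmod (\<xi> y))\<^sup>2)"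
  show ?thesis
  proof (cases "N = 0")
    case True
    then have "\<xi> y = 0" if "y \<in> carrier G" for y
      using that fin by (auto simp: N_def sum_nonneg_eq_0_iff)
    then have "matrix_coeff \<xi> g = 0" if "g \<in> carrier G" for g
      using that by (simp add: matrix_coeff_def)
    then show ?thesis using G by simp
  next
    case False
    let ?v = "vector [-u, 1, c] :: complex ^ 3"
    from False have N: "N > 0" unfolding N_def by (metis less_le sum_nonneg zero_le_power2)
    \<comment> \<open>On the carrier \<open>p\<close> is the matrix coefficient of \<xi> divided by
      \<open>sqrt N\<close>, hence positive definite; \<open>restrict\<close> supplies the
      extensionality required by \<open>state_space\<close>.\<close>
    define p where "p = restrict (\<lambda>g. matrix_coeff \<xi> g / of_real N) (carrier G)"
    have eta: "matrix_coeff (\<lambda>y. \<xi> y / of_real (sqrt N)) g = matrix_coeff \<xi> g / of_real N" for g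
    proof -
      have "(of_real (sqrt N) * of_real (sqrt N) :: complex) = of_real N"
        using N by (simp flip: of_real_mult)
      then show ?thesis by (simp add: matrix_coeff_def sum_divide_distrib)
    qed
    have "positive_definite G p"
      unfolding positive_definite_def
    proof (intro allI impI)
      fix n :: nat and g :: "nat \<Rightarrow> 'a" and d :: "nat \<Rightarrow> complex"
      assume g: "\<forall>j<n. g j \<in> carrier G"
      then have "(\<Sum>j<n. \<Sum>k<n. cnj (d j) * d k * p (inv (g j) \<otimes> g k))
          = (\<Sum>j<n. \<Sum>k<n. cnj (d j) * d k * matrix_coeff (\<lambda>y. \<xi> y / of_real (sqrt N)) (inv (g j) \<otimes> g k))"
        by (intro sum.cong refl) (simp add: p_def eta)
      then show "(\<Sum>j<n. \<Sum>k<n. cnj (d j) * d k * p (inv (g j) \<otimes> g k)) \<in> \<real>\<^sub>\<ge>\<^sub>0"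
        using positive_definite_matrix_coeff[unfolded positive_definite_def, rule_format, of n g] g
        by (simp only:)
    qed
    moreover have "p \<one> = 1" using N by (simp add: p_def matrix_coeff_one N_def[symmetric])
    ultimately have "p \<in> state_space G" by (simp add: state_space_def p_def)
    with Q have "Q_matrix p a b x \<in> positive_matrices" by blast
    then have "(\<Sum>i\<in>UNIV. \<Sum>j\<in>UNIV. cnj (v $ i) * Q_matrix p a b x $ i $ j * v $ j) \<in> \<real>\<^sub>\<ge>\<^sub>0"
      for v :: "complex ^ 3"
      unfolding positive_matrices_def by blast
    then have "0 \<le> Re (\<Sum>i\<in>UNIV. \<Sum>j\<in>UNIV. cnj (?v $ i) * Q_matrix p a b x $ i $ j * ?v $ j)"
      unfolding complex_nonneg_Reals_iff by blast
    also have "\<dots> = (cmod u)\<^sup>2 + 1 + (cmod c)\<^sup>2 + 2 * Re (- cnj u * p a - cnj u * c * p x + c * p b)"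
      unfolding Q_matrix_quadratic_form cmod_power2
      by (simp add: vector_3 algebra_simps power2_eq_square)
    also have "\<dots> = Re ((2 + (cmod c)\<^sup>2) * matrix_coeff \<xi> \<one> - 2 * (cnj u * matrix_coeff \<xi> a)
           + 2 * c * (matrix_coeff \<xi> b - cnj u * matrix_coeff \<xi> x)) / N"
      using N G u by (simp add: p_def matrix_coeff_one N_def[symmetric] field_simps)
    finally show ?thesis using N by (simp add: zero_le_divide_iff)
  qed
qed

section \<open>Eigenvectors of right translation and the sum over eigenvalues\<close>

text \<open>A matrix coefficient of the two-sided regular representation. Here \<open>h\<close> acts
  without the inverse built into \<open>matrix_coeff\<close>, so \<open>inv g\<close> is passed for
  \<open>g\<close>.\<close>

definition bitranslate_coeff :: "('a \<Rightarrow> complex) \<Rightarrow> 'a \<Rightarrow> 'a \<Rightarrow> complex" where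
  "bitranslate_coeff w h t = (\<Sum>y\<in>carrier G. w (h \<otimes> y \<otimes> t) * cnj (w y))"

text \<open>The product of \<open>w\<close> and \<eta>_u in the group algebra, as a function of
  \<open>y\<close>.\<close>

definition eigenvector_of :: "('a \<Rightarrow> complex) \<Rightarrow> 'a \<Rightarrow> complex \<Rightarrow> 'a \<Rightarrow> complex" where
  "eigenvector_of w a u y = (\<Sum>j<order G. u ^ j * w (y \<otimes> a [^] j))"

text \<open>Multiplication by \<open>u\<close> shifts the summation index by one, and the sum wraps
  around because the terms at 0 and at \<open>order G\<close> agree.\<close>

lemma eigenvector_of_translate:
  assumes u: "u ^ order G = 1" "cmod u = 1" and G: "a \<in> carrier G" "y \<in> carrier G"
  shows "cnj u * eigenvector_of w a u y = eigenvector_of w a u (y \<otimes> a)"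
proof -
  let ?F = "\<lambda>j. u ^ j * w (y \<otimes> a [^] j)"
  have "u * eigenvector_of w a u (y \<otimes> a) = (\<Sum>j<order G. ?F (Suc j))"
    unfolding eigenvector_of_def sum_distrib_left using G
    by (intro sum.cong refl) (simp only: power_Suc nat_pow_Suc2 nat_pow_closed m_assoc mult_ac)
  moreover have "?F 0 + (\<Sum>j<order G. ?F (Suc j)) = (\<Sum>j<order G. ?F j) + ?F (order G)"
    unfolding sum.lessThan_Suc_shift[of ?F, symmetric] by simp
  moreover have "?F (order G) = ?F 0" using G u by (simp add: pow_order_eq_1)
  ultimately have "u * eigenvector_of w a u (y \<otimes> a) = eigenvector_of w a u y"
    by (simp add: eigenvector_of_def)
  moreover have "cnj u * u = 1" using u(2) by (simp add: complex_norm_square[symmetric] mult.commute)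
  ultimately show ?thesis by (metis mult.assoc mult_1)
qed

text \<open>Orthogonality of the roots removes the terms with distinct powers of \<open>a\<close>.
  As \<open>t\<close> commutes with \<open>a\<close>, equal powers are absorbed by a right
  translation of \<open>y\<close>, so the remaining \<open>order G\<close> terms coincide.\<close>

lemma sum_eigenvector_of:
  assumes G: "a \<in> carrier G" "h \<in> carrier G" "t \<in> carrier G" "t \<otimes> a = a \<otimes> t"
  defines "u \<equiv> \<lambda>k. cis (2 * pi * real k / real (order G))"
  shows "(\<Sum>k<order G. \<Sum>y\<in>carrier G.
            eigenvector_of w a (u k) (h \<otimes> y \<otimes> t) * cnj (eigenvector_of w a (u k) y))
         = (of_nat (order G))\<^sup>2 * bitranslate_coeff w h t"
proof -
  let ?n = "order G"
  let ?W = "\<lambda>y i j. w (h \<otimes> y \<otimes> t \<otimes> a [^] (i::nat)) * cnj (w (y \<otimes> a [^] (j::nat)))"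
  have "(\<Sum>k<?n. eigenvector_of w a (u k) (h \<otimes> y \<otimes> t) * cnj (eigenvector_of w a (u k) y))
      = of_nat ?n * (\<Sum>i<?n. ?W y i i)" for y
  proof -
    have "(\<Sum>k<?n. eigenvector_of w a (u k) (h \<otimes> y \<otimes> t) * cnj (eigenvector_of w a (u k) y))
        = (\<Sum>k<?n. \<Sum>i<?n. \<Sum>j<?n. ?W y i j * (u k ^ i * cnj (u k ^ j)))"
      unfolding eigenvector_of_def cnj_sum sum_product by (simp add: mult_ac)
    also have "\<dots> = (\<Sum>i<?n. \<Sum>k<?n. \<Sum>j<?n. ?W y i j * (u k ^ i * cnj (u k ^ j)))"
      by (rule sum.swap)
    also have "\<dots> = (\<Sum>i<?n. \<Sum>j<?n. \<Sum>k<?n. ?W y i j * (u k ^ i * cnj (u k ^ j)))"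
      by (intro sum.cong refl sum.swap)
    also have "\<dots> = (\<Sum>i<?n. \<Sum>j<?n. ?W y i j * (if i = j then of_nat ?n else 0))"
      unfolding sum_distrib_left[symmetric] u_def
      by (intro sum.cong refl) (simp only: sum_roots_of_unity_power lessThan_iff)
    also have "\<dots> = of_nat ?n * (\<Sum>i<?n. ?W y i i)"
      by (simp add: if_distrib sum_distrib_left mult_ac cong: if_cong)
    finally show ?thesis .
  qed
  then have "(\<Sum>k<?n. \<Sum>y\<in>carrier G.
            eigenvector_of w a (u k) (h \<otimes> y \<otimes> t) * cnj (eigenvector_of w a (u k) y))
      = of_nat ?n * (\<Sum>y\<in>carrier G. \<Sum>i<?n. ?W y i i)"
    by (subst sum.swap) (simp add: sum_distrib_left)
  also have "(\<Sum>y\<in>carrier G. \<Sum>i<?n. ?W y i i) = (\<Sum>i<?n. \<Sum>y\<in>carrier G. ?W y i i)"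
    by (rule sum.swap)
  also have "\<dots> = (\<Sum>i<?n. bitranslate_coeff w h t)"
  proof (rule sum.cong[OF refl])
    fix i :: nat
    have comm: "t \<otimes> a [^] i = a [^] i \<otimes> t"
      using group_commutes_pow[OF G(4)[symmetric] G(1,3)] by simp
    have "?W y i i = w (h \<otimes> (y \<otimes> a [^] i) \<otimes> t) * cnj (w (y \<otimes> a [^] i))" if "y \<in> carrier G" for y
      using that G comm by (simp add: m_assoc)
    then have "(\<Sum>y\<in>carrier G. ?W y i i)
        = (\<Sum>y\<in>carrier G. w (h \<otimes> (y \<otimes> a [^] i) \<otimes> t) * cnj (w (y \<otimes> a [^] i)))"
      by (intro sum.cong) auto
    also have "\<dots> = bitranslate_coeff w h t"
      unfolding bitranslate_coeff_def
      using sum_right_translate[of "a [^] i" "\<lambda>y. w (h \<otimes> y \<otimes> t) * cnj (w y)"] G by simp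
    finally show "(\<Sum>y\<in>carrier G. ?W y i i) = bitranslate_coeff w h t" .
  qed
  finally show ?thesis by (simp add: power2_eq_square)
qed

text \<open>Summing over the roots eliminates them: a factor \<open>cnj (u k)\<close> becomes a
  right translation by \<open>a\<close>, while terms without it keep \<open>\<one>\<close> on the
  right.\<close>

lemma form_bitranslate_coeff_nonneg:
  assumes fin: "finite (carrier G)"
    and Q: "\<forall>p\<in>state_space G. Q_matrix p a b x \<in> positive_matrices"
    and G: "a \<in> carrier G" "b \<in> carrier G" "x \<in> carrier G"
  shows "Re ((2 + (cmod c)\<^sup>2) * bitranslate_coeff w \<one> \<one> - 2 * bitranslate_coeff w (inv a) a
           + 2 * c * (bitranslate_coeff w (inv b) \<one> - bitranslate_coeff w (inv x) a)) \<ge> 0"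
    (is "Re ?R \<ge> 0")
proof -
  let ?n = "order G"
  define u where "u = (\<lambda>k. cis (2 * pi * real k / real ?n))"
  define \<xi> where "\<xi> = (\<lambda>k. eigenvector_of w a (u k))"
  have n: "?n > 0" using fin by (simp add: order_gt_0_iff_finite)
  have u: "cmod (u k) = 1" "u k ^ ?n = 1" for k
    using n by (simp_all add: u_def Complex.DeMoivre cis_multiple_2pi)
  have m1: "(\<Sum>k<?n. matrix_coeff (\<xi> k) g) = (of_nat ?n)\<^sup>2 * bitranslate_coeff w (inv g) \<one>"
    if "g \<in> carrier G" for g
    using sum_eigenvector_of[OF G(1) inv_closed[OF that] one_closed, of w] that G
    by (simp add: matrix_coeff_def \<xi>_def u_def cong: sum.cong)
  have m2: "(\<Sum>k<?n. cnj (u k) * matrix_coeff (\<xi> k) g) = (of_nat ?n)\<^sup>2 * bitranslate_coeff w (inv g) a"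
    if "g \<in> carrier G" for g
  proof -
    have "cnj (u k) * matrix_coeff (\<xi> k) g
        = (\<Sum>y\<in>carrier G. \<xi> k (inv g \<otimes> y \<otimes> a) * cnj (\<xi> k y))" for k
      unfolding matrix_coeff_def sum_distrib_left \<xi>_def mult.assoc[symmetric]
      using that G by (intro sum.cong refl) (simp add: eigenvector_of_translate u)
    then show ?thesis
      using sum_eigenvector_of[OF G(1) inv_closed[OF that] G(1), of w]
      by (simp add: \<xi>_def u_def)
  qed
  have "0 \<le> (\<Sum>k<?n. Re ((2 + (cmod c)\<^sup>2) * matrix_coeff (\<xi> k) \<one> - 2 * (cnj (u k) * matrix_coeff (\<xi> k) a)
           + 2 * c * (matrix_coeff (\<xi> k) b - cnj (u k) * matrix_coeff (\<xi> k) x)))"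
    by (intro sum_nonneg form_matrix_coeff_nonneg[OF fin Q G u(1)])
  also have "\<dots> = Re ((of_nat ?n)\<^sup>2 * ?R)"
    unfolding Re_sum[symmetric] sum.distrib sum_subtractf sum_distrib_left[symmetric]
    using G by (simp only: m1 m2 one_closed inv_one) (simp only: algebra_simps)
  also have "\<dots> = (real ?n)\<^sup>2 * Re ?R"
  proof -
    have "(of_nat ?n)\<^sup>2 = complex_of_real ((real ?n)\<^sup>2)" by simp
    then show ?thesis
      by (simp only: times_complex.sel Re_complex_of_real Im_complex_of_real mult_zero_left diff_zero)
  qed
  finally show ?thesis using n by (simp add: zero_le_mult_iff)
qed

section \<open>Fourth-root averaging and the test functions\<close>

lemma sum_point_mass_mult:
  assumes "finite (carrier G)" "g \<in> carrier G"
  shows "(\<Sum>y\<in>carrier G. (if y = g then 1 else 0) * F y) = (F g :: complex)"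
  using assms by (simp add: if_distrib[of "\<lambda>z. z * _"] sum.delta cong: if_cong)

lemma averaged_form_nonneg:
  fixes f h :: "'a \<Rightarrow> real"
  assumes fin: "finite (carrier G)"
    and Q: "\<forall>p\<in>state_space G. Q_matrix p a b x \<in> positive_matrices"
    and G: "a \<in> carrier G" "b \<in> carrier G" "x \<in> carrier G"
  defines "E \<equiv> \<lambda>f. 9 / 4 * (\<Sum>y\<in>carrier G. (f y)\<^sup>2) - 2 * (\<Sum>y\<in>carrier G. f (inv a \<otimes> y \<otimes> a) * f y)"
  shows "0 \<le> 1 / 4 + (E f + f b - f (x \<otimes> inv a)) + (E h + h (inv b) - h (inv x \<otimes> a))"
proof -
  define e :: "'a \<Rightarrow> complex" where "e = (\<lambda>y. if y = \<one> then 1 else 0)"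
  define w where "w = (\<lambda>c y. e y + c * of_real (f y) + cnj c * of_real (h y))"
  define C where "C = {1, -1, \<i>, -\<i>}"
  \<comment> \<open>\<open>B\<close> polarises \<open>bitranslate_coeff\<close>; the averages pair
    different functions in its two slots.\<close>
  define B where "B = (\<lambda>u v p t. \<Sum>y\<in>carrier G. u (p \<otimes> y \<otimes> t) * cnj (v y) :: complex)"
  define f' h' :: "'a \<Rightarrow> complex" where "f' = (\<lambda>y. of_real (f y))" and "h' = (\<lambda>y. of_real (h y))"
  have avg: "(\<Sum>c\<in>C. bitranslate_coeff (w c) p t) = 4 * (B e e p t + B f' f' p t + B h' h' p t)" for p t
    unfolding bitranslate_coeff_def w_def C_def
    by (subst sum.swap)
       (simp only: average_fourth_roots B_def f'_def h'_def sum.distrib sum_distrib_left[symmetric])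
  have avg_c: "(\<Sum>c\<in>C. c * bitranslate_coeff (w c) p t) = 4 * (B e f' p t + B h' e p t)" for p t
    unfolding bitranslate_coeff_def w_def C_def sum_distrib_left
    by (subst sum.swap)
       (simp only: average_fourth_roots B_def f'_def h'_def sum.distrib sum_distrib_left[symmetric])
  \<comment> \<open>With the point mass \<open>e\<close> in either slot, \<open>B\<close> becomes a
    point evaluation; this produces the linear terms.\<close>
  have Bv: "B u e p t = u (p \<otimes> t)" if "p \<in> carrier G" "t \<in> carrier G" for u p t
  proof -
    have "B u e p t = (\<Sum>y\<in>carrier G. (if y = \<one> then 1 else 0) * u (p \<otimes> y \<otimes> t))"
      unfolding B_def e_def by (intro sum.cong) auto
    then show ?thesis using that by (simp add: sum_point_mass_mult fin)
  qed
  have Be: "B e v p t = cnj (v (inv p \<otimes> inv t))" if "p \<in> carrier G" "t \<in> carrier G" for v p t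
  proof -
    have "p \<otimes> y \<otimes> t = \<one> \<longleftrightarrow> y = inv p \<otimes> inv t" if "y \<in> carrier G" for y
    proof -
      have "p \<otimes> y \<otimes> t = \<one> \<longleftrightarrow> p \<otimes> y = inv t"
        using that \<open>p \<in> carrier G\<close> \<open>t \<in> carrier G\<close> by (metis inv_equality inv_solve_right l_inv m_closed)
      also have "\<dots> \<longleftrightarrow> y = inv p \<otimes> inv t"
        using that \<open>p \<in> carrier G\<close> \<open>t \<in> carrier G\<close> by (metis inv_closed inv_solve_left)
      finally show ?thesis .
    qed
    then have "B e v p t = (\<Sum>y\<in>carrier G. (if y = inv p \<otimes> inv t then 1 else 0) * cnj (v y))"
      unfolding B_def e_def by (intro sum.cong) auto
    then show ?thesis using that by (simp add: sum_point_mass_mult fin)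
  qed
  have BE: "Re (9 / 4 * B (\<lambda>y. of_real (g y)) (\<lambda>y. of_real (g y)) \<one> \<one>
      - 2 * B (\<lambda>y. of_real (g y)) (\<lambda>y. of_real (g y)) (inv a) a) = E g" for g
    unfolding E_def B_def by (simp add: power2_eq_square cong: sum.cong)
  have "0 \<le> (\<Sum>c\<in>C. Re (9 / 4 * bitranslate_coeff (w c) \<one> \<one> - 2 * bitranslate_coeff (w c) (inv a) a
           + (c * bitranslate_coeff (w c) (inv b) \<one> - c * bitranslate_coeff (w c) (inv x) a)))"
  proof (intro sum_nonneg)
    fix c assume "c \<in> C"
    \<comment> \<open>Halving \<open>c\<close> gives \<open>2 + 1 / 4 = 9 / 4\<close> as leading
      coefficient and \<open>2 * (c / 2) = c\<close> as linear one.\<close>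
    then have "cmod (c / 2) = 1 / 2" by (auto simp: C_def norm_divide)
    then show "0 \<le> Re (9 / 4 * bitranslate_coeff (w c) \<one> \<one> - 2 * bitranslate_coeff (w c) (inv a) a
           + (c * bitranslate_coeff (w c) (inv b) \<one> - c * bitranslate_coeff (w c) (inv x) a))"
      using form_bitranslate_coeff_nonneg[OF fin Q G, of "c / 2" "w c"]
      by (simp only:) (simp add: power2_eq_square algebra_simps)
  qed
  also have "\<dots> = 4 * Re (9 / 4 * (B e e \<one> \<one> + B f' f' \<one> \<one> + B h' h' \<one> \<one>)
      - 2 * (B e e (inv a) a + B f' f' (inv a) a + B h' h' (inv a) a)
      + (B e f' (inv b) \<one> + B h' e (inv b) \<one> - (B e f' (inv x) a + B h' e (inv x) a)))"
    unfolding Re_sum[symmetric] sum.distrib sum_subtractf sum_distrib_left[symmetric] avg avg_c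
    by simp
  \<comment> \<open>The constant is \<open>9 / 4 - 2\<close>, since conjugation by \<open>a\<close>
    fixes the point mass at \<open>\<one>\<close>.\<close>
  also have "\<dots> = 4 * (1 / 4 + E f + E h + (f b + h (inv b) - (f (x \<otimes> inv a) + h (inv x \<otimes> a))))"
    unfolding BE[symmetric] using G
    by (simp add: Bv Be f'_def h'_def) (simp add: e_def)
  finally show ?thesis by simp
qed

text \<open>The bound is half of the constant \<open>1 / 4\<close> to be beaten. With values
  \<open>s\<close> at \<open>p\<close> and \<open>- s\<close> at \<open>q\<close>, the expression is
  at most \<open>13 / 2 * s\<^sup>2 - 2 * s\<close>. If conjugation by \<open>a\<close> swapped
  \<open>p\<close> and \<open>q\<close>, it would be \<open>17 / 2 * s\<^sup>2 - 2 * s\<close>,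
  whose minimum \<open>- (2 / 17)\<close> is too large.\<close>

lemma averaged_form_negative:
  assumes fin: "finite (carrier G)"
    and G: "a \<in> carrier G" "p \<in> carrier G" "q \<in> carrier G"
    and pq: "p \<noteq> q" "inv a \<otimes> p \<otimes> a \<noteq> q \<or> inv a \<otimes> q \<otimes> a \<noteq> p"
  obtains f :: "'a \<Rightarrow> real" where
    "9 / 4 * (\<Sum>y\<in>carrier G. (f y)\<^sup>2) - 2 * (\<Sum>y\<in>carrier G. f (inv a \<otimes> y \<otimes> a) * f y)
       + f q - f p < - (1 / 8)"
proof
  \<comment> \<open>The height \<open>1 / 6\<close> is close to the minimiser \<open>2 / 13\<close>
    and gives the bound \<open>- (11 / 72)\<close>.\<close>
  define f :: "'a \<Rightarrow> real" where "f = (\<lambda>y. if y = p then 1 / 6 else if y = q then - (1 / 6) else 0)"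
  have sum_f: "(\<Sum>y\<in>carrier G. F y * f y) = (F p - F q) / 6" for F
  proof -
    have "(\<Sum>y\<in>carrier G. F y * f y) = (\<Sum>y\<in>{p, q}. F y * f y)"
      using fin G by (intro sum.mono_neutral_right) (auto simp: f_def)
    then show ?thesis using pq(1) by (simp add: f_def field_simps)
  qed
  show "9 / 4 * (\<Sum>y\<in>carrier G. (f y)\<^sup>2) - 2 * (\<Sum>y\<in>carrier G. f (inv a \<otimes> y \<otimes> a) * f y)
       + f q - f p < - (1 / 8)"
  proof -
    \<comment> \<open>Since \<open>f\<close> takes only the values \<open>1 / 6\<close>, 0 and
      \<open>- (1 / 6)\<close>, a smaller difference needs \<open>u = q\<close> and
      \<open>v = p\<close>.\<close>
    have "f u - f v \<ge> - (1 / 6)" if "u \<noteq> q \<or> v \<noteq> p" for u v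
      using that pq(1) by (auto simp: f_def)
    from this[OF pq(2)] have "f (inv a \<otimes> p \<otimes> a) - f (inv a \<otimes> q \<otimes> a) \<ge> - (1 / 6)" .
    moreover have "f p = 1 / 6" "f q = - (1 / 6)"
      using pq(1) by (auto simp: f_def)
    ultimately show ?thesis
      unfolding power2_eq_square sum_f by (simp add: field_simps)
  qed
qed

end

theorem theorem3p4:
  fixes G :: "('a, 'b) monoid_scheme" and a b x :: 'a
  assumes "group G" and "finite (carrier G)"
    and "a \<in> carrier G" and "b \<in> carrier G" and "x \<in> carrier G"
  shows "(\<forall>p \<in> state_space G. Q_matrix p a b x \<in> positive_matrices) \<longleftrightarrow>
           x = a \<otimes>\<^bsub>G\<^esub> b \<or> x = b \<otimes>\<^bsub>G\<^esub> a"
proof -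
  interpret group G by fact
  note fin = assms(2) and G = assms(3-5)
  show ?thesis
  proof
    assume Q: "\<forall>p\<in>state_space G. Q_matrix p a b x \<in> positive_matrices"
    show "x = a \<otimes>\<^bsub>G\<^esub> b \<or> x = b \<otimes>\<^bsub>G\<^esub> a"
    proof (rule ccontr)
      assume "\<not> ?thesis"
      then have ne: "x \<noteq> a \<otimes>\<^bsub>G\<^esub> b" "x \<noteq> b \<otimes>\<^bsub>G\<^esub> a" by auto
      \<comment> \<open>For \<open>?p\<close> and \<open>b\<close>, the condition x \<noteq> ba
        makes the points distinct and x \<noteq> ab prevents the swap. For \<open>?q\<close> and
        \<open>inv b\<close> the two conditions exchange roles.\<close>
      let ?p = "x \<otimes>\<^bsub>G\<^esub> inv\<^bsub>G\<^esub> a" and ?q = "inv\<^bsub>G\<^esub> x \<otimes>\<^bsub>G\<^esub> a"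
      have p1: "?p \<noteq> b"
      proof
        assume "?p = b"
        then have "b \<otimes>\<^bsub>G\<^esub> a = ?p \<otimes>\<^bsub>G\<^esub> a" by simp
        also have "\<dots> = x" using G by (simp add: m_assoc)
        finally show False using ne(2) by simp
      qed
      have p2: "inv\<^bsub>G\<^esub> a \<otimes>\<^bsub>G\<^esub> ?p \<otimes>\<^bsub>G\<^esub> a \<noteq> b"
      proof
        assume "inv\<^bsub>G\<^esub> a \<otimes>\<^bsub>G\<^esub> ?p \<otimes>\<^bsub>G\<^esub> a = b"
        then have "a \<otimes>\<^bsub>G\<^esub> b = a \<otimes>\<^bsub>G\<^esub> (inv\<^bsub>G\<^esub> a \<otimes>\<^bsub>G\<^esub> ?p \<otimes>\<^bsub>G\<^esub> a)" by simp
        also have "\<dots> = a \<otimes>\<^bsub>G\<^esub> (inv\<^bsub>G\<^esub> a \<otimes>\<^bsub>G\<^esub> x)" using G by (simp add: m_assoc)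
        also have "\<dots> = x" using G by (simp add: m_assoc[symmetric])
        finally show False using ne(1) by simp
      qed
      have q1: "?q \<noteq> inv\<^bsub>G\<^esub> b"
      proof
        assume "?q = inv\<^bsub>G\<^esub> b"
        then have "x \<otimes>\<^bsub>G\<^esub> ?q \<otimes>\<^bsub>G\<^esub> b = x \<otimes>\<^bsub>G\<^esub> inv\<^bsub>G\<^esub> b \<otimes>\<^bsub>G\<^esub> b" by simp
        also have "\<dots> = x" using G by (simp add: m_assoc)
        also have "x \<otimes>\<^bsub>G\<^esub> ?q = a" using G by (simp add: m_assoc[symmetric])
        finally show False using ne(1) by simp
      qed
      have q2: "inv\<^bsub>G\<^esub> a \<otimes>\<^bsub>G\<^esub> inv\<^bsub>G\<^esub> b \<otimes>\<^bsub>G\<^esub> a \<noteq> ?q"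
      proof
        assume "inv\<^bsub>G\<^esub> a \<otimes>\<^bsub>G\<^esub> inv\<^bsub>G\<^esub> b \<otimes>\<^bsub>G\<^esub> a = ?q"
        then have "inv\<^bsub>G\<^esub> (b \<otimes>\<^bsub>G\<^esub> a) = inv\<^bsub>G\<^esub> x"
          using G by (simp add: inv_mult_group)
        then show False using ne(2) G by (metis inv_inv m_closed)
      qed
      obtain f where f: "9 / 4 * (\<Sum>y\<in>carrier G. (f y)\<^sup>2)
          - 2 * (\<Sum>y\<in>carrier G. f (inv\<^bsub>G\<^esub> a \<otimes>\<^bsub>G\<^esub> y \<otimes>\<^bsub>G\<^esub> a) * f y) + f b - f ?p < - (1 / 8 :: real)"
        using averaged_form_negative[OF fin G(1) _ G(2) p1] p2 G(1,3) by blast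
      obtain h where h: "9 / 4 * (\<Sum>y\<in>carrier G. (h y)\<^sup>2)
          - 2 * (\<Sum>y\<in>carrier G. h (inv\<^bsub>G\<^esub> a \<otimes>\<^bsub>G\<^esub> y \<otimes>\<^bsub>G\<^esub> a) * h y) + h (inv\<^bsub>G\<^esub> b) - h ?q < - (1 / 8 :: real)"
        using averaged_form_negative[OF fin G(1) _ _ q1] q2 G by blast
      \<comment> \<open>Two contributions below \<open>- (1 / 8)\<close> outweigh the constant
        \<open>1 / 4\<close>.\<close>
      show False using averaged_form_nonneg[OF fin Q G, of f h] f h by linarith
    qed
  next
    assume "x = a \<otimes>\<^bsub>G\<^esub> b \<or> x = b \<otimes>\<^bsub>G\<^esub> a"
    then show "\<forall>p\<in>state_space G. Q_matrix p a b x \<in> positive_matrices"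
      using G Q_matrix_positive_if_mult Q_matrix_positive_if_mult_swap
      unfolding state_space_def by blast
  qed
qed

end
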